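(* (Monotonicity Theorem) For $\alpha=1/2$, the curve $\partial_0N_+$ in the $XY$ plane is the graph of a non-increasing function in Cartesian coordinates (the second coordinate as a function of the first), where $$\partial_0 N_+=\Big\{\big(a_{x_0}(P(x_0)/2),\,b_{x_0}(P(x_0)/2),\,0\big)\;:\;x_0\in\big(1/\sqrt3,\,1\big)\Big\}.$$
   Context: For $x_0\in(1/\sqrt3,1)$ let $(x,y,z,a,b)(t)$ be the solution of $$x'=-xz,\quad y'=\tfrac12yz,\quad z'=x^2-\tfrac12y^2,\quad a'=2x+az,\quad b'=2y-\tfrac12bz,$$ with $x(0)=x_0$, $y(0)=\sqrt{1-x_0^2}$, $z(0)=a(0)=b(0)=0$; write $a_{x_0},b_{x_0}$ for its last two components. The curve $(x(t),y(t),z(t))$ is a closed curve on the unit sphere, and $P(x_0)$ is its (minimal) period. Geometric meaning: let $G_{1/2}$ be $\mathbb{R}^3$ with the left-invariant metric $ds^2=e^{-2z}dx^2+e^{z}dy^2+dz^2$ for the group law $(x,y,z)\ast(x',y',z')=(x'e^z+x,y'e^{-z/2}+y,z'+z)$. Then $(a_{x_0}(t),b_{x_0}(t),0)$ is the endpoint of the geodesic starting at the identity with initial unit vector $(x(t),y(t),z(t))$ in the left-invariant orthonormal frame $e^z\partial_x,e^{-z/2}\partial_y,\partial_z$ and length $2t$. For $t=P(x_0)/2$ one gets the endpoints of perfect geodesic segments (segments whose length equals the period). *)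

theory Defs
  imports "HOL-Analysis.Analysis"
begin

definition geodesic_ivp ::
  "real \<Rightarrow> (real \<Rightarrow> real) \<Rightarrow> (real \<Rightarrow> real) \<Rightarrow> (real \<Rightarrow> real) \<Rightarrow> (real \<Rightarrow> real) \<Rightarrow> (real \<Rightarrow> real) \<Rightarrow> bool"
  where
  "geodesic_ivp x0 x y z a b \<longleftrightarrow>
     x 0 = x0 \<and> y 0 = sqrt (1 - x0\<^sup>2) \<and> z 0 = 0 \<and> a 0 = 0 \<and> b 0 = 0 \<and>
     (\<forall>t. (x has_real_derivative - x t * z t) (at t)) \<and>
     (\<forall>t. (y has_real_derivative 1/2 * y t * z t) (at t)) \<and>
     (\<forall>t. (z has_real_derivative (x t)\<^sup>2 - 1/2 * (y t)\<^sup>2) (at t)) \<and>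
     (\<forall>t. (a has_real_derivative 2 * x t + a t * z t) (at t)) \<and>
     (\<forall>t. (b has_real_derivative 2 * y t - 1/2 * b t * z t) (at t))"

(* The value is unspecified if there is no least positive period. *)
definition minimal_period :: "(real \<Rightarrow> 'a) \<Rightarrow> real" where
  "minimal_period c = (LEAST p. 0 < p \<and> (\<forall>t. c (t + p) = c t))"

(* The arguments are families of functions of time, indexed by the initial value x0. *)
definition boundary0_N_plus ::
  "(real \<Rightarrow> real \<Rightarrow> real) \<Rightarrow> (real \<Rightarrow> real \<Rightarrow> real) \<Rightarrow> (real \<Rightarrow> real \<Rightarrow> real) \<Rightarrow>
   (real \<Rightarrow> real \<Rightarrow> real) \<Rightarrow> (real \<Rightarrow> real \<Rightarrow> real) \<Rightarrow> (real \<times> real \<times> real) set"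
  where
  "boundary0_N_plus x y z a b =
     {(a x0 (P / 2), b x0 (P / 2), 0) | x0 P.
        x0 \<in> {1 / sqrt 3 <..< 1} \<and> P = minimal_period (\<lambda>t. (x x0 t, y x0 t, z x0 t))}"

end

(* Write x0 = s (1 + r) with s^2 (3 + r^2) = 1 and 0 < r < 1. The conserved quantities
   x^2 + y^2 + z^2 and x y^2 turn the equations for x and z into a motion on a circle:
   x = s (1 + r cos theta) with theta' = sqrt (x (x + 2 s)). Hence the period corresponds to
   theta = 2 pi and half of it to theta = pi. Since (a x)' = 2 x^2 and (b y + 4 z)' = 4 x^2,
   both endpoint coordinates reduce to F(r) = integral of f (r cos theta) over [0, pi], where
   f u = (1 + u) sqrt ((1 + u) / (3 + u)):
     a = 2 F(r) / (1 - r),   b = 4 F(r) / sqrt (2 + 2 r).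
   The profile f is convex, so F is nondecreasing and a increases with r; the tangent
   inequality also gives F(r') - F(r) <= (r' - r) / 2, because cos theta f' (cos theta)
   integrates to 1/2. With F(1) = 2 this yields F(r) >= (3 + r) / 2, hence b decreases. *)
theory Submission imports Defs begin

section \<open>The profile function and its convexity\<close>

definition prof :: "real \<Rightarrow> real" where
  "prof u = (1 + u) * sqrt ((1 + u) / (3 + u))"

text \<open>At \<open>u = -1\<close> the formula gives 0, so estimates with \<open>prof'\<close>
  extend to the endpoint \<open>cos t = -1\<close>, which \<open>prof_has_derivative\<close> leaves
  out.\<close>

definition prof' :: "real \<Rightarrow> real" where
  "prof' u = sqrt ((1 + u) / (3 + u)) * (4 + u) / (3 + u)"

definition profint :: "real \<Rightarrow> real" where
  "profint r = integral {0..pi} (\<lambda>\<theta>. prof (r * cos \<theta>))"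

lemma prof_has_derivative:
  assumes "-1 < u"
  shows "(prof has_real_derivative prof' u) (at u)"
proof -
  define q where "q = sqrt ((1 + u) / (3 + u))"
  have q: "q > 0" "q\<^sup>2 = (1 + u) / (3 + u)" using assms by (auto simp: q_def)
  have ne: "3 + u \<noteq> 0" "1 + u \<noteq> 0" using assms by auto
  have "(prof has_real_derivative
      q + (1 + u) * (((3 + u) - (1 + u)) / (3 + u)\<^sup>2 * inverse q / 2)) (at u)"
    using assms by (auto intro!: derivative_eq_intros 
      simp: prof_def[abs_def] q_def mult_ac power2_eq_square divide_less_0_iff)
  also have "(1 + u) * (((3 + u) - (1 + u)) / (3 + u)\<^sup>2 * inverse q / 2)
      = ((1 + u) / (3 + u)) / (q * (3 + u))"
    using ne q(1) by (simp add: divide_simps power2_eq_square)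
  also have "\<dots> = q / (3 + u)"
    using ne q(1) unfolding q(2)[symmetric] by (simp add: power2_eq_square)
  also have "q + q / (3 + u) = prof' u"
    using ne unfolding prof'_def q_def[symmetric] by (simp add: divide_simps algebra_simps)
  finally show ?thesis .
qed

text \<open>With v = 3 + u the square of \<open>prof' u\<close> is (v - 2) (v + 1)^2 / v^3. Expanded
  in powers of 1/v, every non-constant term is increasing in v, which is all that
  \<open>prof'_mono\<close> needs.\<close>

lemma prof'_eq:
  assumes "-1 \<le> u"
  shows "prof' u = sqrt (1 - 3 / (3 + u)\<^sup>2 - 2 / (3 + u) ^ 3)"
proof -
  define v where "v = 3 + u"
  have v: "v \<ge> 2" "u = v - 3" using assms by (auto simp: v_def)
  have "1 - 3 / v\<^sup>2 - 2 / v ^ 3 = (v - 2) / v * ((v + 1) / v)\<^sup>2"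
    using v(1) by (simp add: field_simps power2_eq_square power3_eq_cube)
  then have "sqrt (1 - 3 / v\<^sup>2 - 2 / v ^ 3) = sqrt ((v - 2) / v) * ((v + 1) / v)"
    using v(1) real_sqrt_mult[of "(v - 2) / v" "((v + 1) / v)\<^sup>2"] by simp
  then show ?thesis unfolding prof'_def v_def[symmetric] by (simp add: v algebra_simps)
qed

lemma prof'_mono:
  assumes "-1 \<le> u" "u \<le> v"
  shows "prof' u \<le> prof' v"
proof -
  have "3 / (3 + v)\<^sup>2 \<le> 3 / (3 + u)\<^sup>2" "2 / (3 + v) ^ 3 \<le> 2 / (3 + u) ^ 3"
    using assms by (intro divide_left_mono power_mono mult_pos_pos zero_less_power; simp)+
  then show ?thesis using assms by (simp add: prof'_eq)
qed

lemma continuous_on_prof: "continuous_on {-1..} prof"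
  unfolding prof_def by (intro continuous_intros) auto

text \<open>By the mean value theorem the difference quotient is \<open>prof' w\<close> for some w
  strictly between u and v, and \<open>prof'_mono\<close> compares it with \<open>prof' v\<close>.
  Derivatives are taken only inside the interval, so -1 may be one of its ends.\<close>

lemma prof_tangent:
  assumes "-1 \<le> u" "-1 \<le> v"
  shows "prof v - prof u \<le> (v - u) * prof' v"
proof (cases u v rule: linorder_cases)
  case less
  have "\<exists>l w. u < w \<and> w < v \<and> DERIV prof w :> l \<and> prof v - prof u = (v - u) * l"
    using less assms
    by (intro MVT continuous_on_subset[OF continuous_on_prof])
       (auto simp: real_differentiable_def intro!: exI prof_has_derivative)
  then obtain l w where w: "u < w" "w < v" "DERIV prof w :> l" "prof v - prof u = (v - u) * l"
    by blast
  have "l = prof' w" using w(1,3) assms prof_has_derivative[of w] DERIV_unique by force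
  then show ?thesis using w assms less prof'_mono[of w v] by simp
next
  case greater
  have "\<exists>l w. v < w \<and> w < u \<and> DERIV prof w :> l \<and> prof u - prof v = (u - v) * l"
    using greater assms
    by (intro MVT continuous_on_subset[OF continuous_on_prof])
       (auto simp: real_differentiable_def intro!: exI prof_has_derivative)
  then obtain l w where w: "v < w" "w < u" "DERIV prof w :> l" "prof u - prof v = (u - v) * l"
    by blast
  have "l = prof' w" using w(1,3) assms prof_has_derivative[of w] DERIV_unique by force
  then have "(u - v) * prof' v \<le> prof u - prof v"
    using w assms greater prof'_mono[of v w] by simp
  then show ?thesis by (simp add: algebra_simps)
qed auto

section \<open>The integral of the profile over half a turn\<close>

lemma mult_cos_ge:
  fixes r t :: real
  assumes "0 \<le> r" "r \<le> 1"
  shows "-1 \<le> r * cos t"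
proof -
  have "\<bar>r * cos t\<bar> \<le> 1 * 1" unfolding abs_mult using assms by (intro mult_mono) auto
  then show ?thesis by auto
qed

lemma prof_integrable:
  assumes "0 \<le> r" "r \<le> 1"
  shows "(\<lambda>t. prof (r * cos t)) integrable_on {0..pi}"
  using mult_cos_ge[OF assms]
  by (intro integrable_continuous_real continuous_on_compose2[OF continuous_on_prof])
     (auto intro!: continuous_intros)

text \<open>The substitution w = sin (t / 2) turns integrands at r = 1 into algebraic functions of w
  containing only sqrt (2 - w^2), for which primitives can be written down.\<close>

lemma half_angle:
  assumes "0 \<le> t" "t \<le> pi"
  defines "w \<equiv> sin (t / 2)"
  shows "cos t = 1 - 2 * w\<^sup>2" "cos (t / 2) \<ge> 0" "w\<^sup>2 \<le> 1" "(cos (t / 2))\<^sup>2 = 1 - w\<^sup>2"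
    "sqrt ((1 + cos t) / (3 + cos t)) = cos (t / 2) / sqrt (2 - w\<^sup>2)"
proof -
  show 1: "cos t = 1 - 2 * w\<^sup>2" using cos_double_sin[of "t / 2"] by (simp add: w_def)
  show 2: "cos (t / 2) \<ge> 0" using assms by (intro cos_ge_zero) auto
  show 3: "w\<^sup>2 \<le> 1" by (simp add: w_def abs_square_le_1)
  show 4: "(cos (t / 2))\<^sup>2 = 1 - w\<^sup>2" by (simp add: w_def cos_squared_eq)
  have "(1 + cos t) / (3 + cos t) = (cos (t / 2))\<^sup>2 / (2 - w\<^sup>2)"
    unfolding 1 4 using 3 by (simp add: divide_simps) (simp add: algebra_simps)
  then show "sqrt ((1 + cos t) / (3 + cos t)) = cos (t / 2) / sqrt (2 - w\<^sup>2)"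
    using 2 by (simp add: real_sqrt_divide)
qed

lemma profint_1: "profint 1 = 2"
proof -
  \<comment> \<open>In the variable w = sin (t / 2) the integrand is 4 (1 - w^2) / sqrt (2 - w^2)
    dw, with primitive 2 w sqrt (2 - w^2).\<close>
  define W where "W = (\<lambda>t::real. 2 * sin (t / 2) * sqrt (2 - (sin (t / 2))\<^sup>2))"
  have "((\<lambda>t. prof (cos t)) has_integral W pi - W 0) {0..pi}"
  proof (rule fundamental_theorem_of_calculus)
    fix t :: real assume t: "t \<in> {0..pi}"
    define w where "w = sin (t / 2)"
    define q where "q = sqrt (2 - w\<^sup>2)"
    have h: "cos t = 1 - 2 * w\<^sup>2" "w\<^sup>2 \<le> 1" "sqrt ((1 + cos t) / (3 + cos t)) = cos (t / 2) / q"
      using half_angle[of t] t unfolding w_def q_def by auto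
    have q: "q > 0" "q * q = 2 - w * w" using h(2) unfolding q_def
      by (auto simp: power2_eq_square)
    have "(W has_real_derivative
        cos (t / 2) * q + 2 * w * (- (2 * w * (cos (t / 2) / 2)) * inverse q / 2)) (at t)"
      unfolding W_def q_def w_def using h(2) unfolding w_def
      by (auto intro!: derivative_eq_intros simp: field_simps)
    also have "cos (t / 2) * q + 2 * w * (- (2 * w * (cos (t / 2) / 2)) * inverse q / 2)
       = cos (t / 2) / q * (q * q - w * w)"
      using q(1) by (simp add: field_simps)
    also have "\<dots> = prof (cos t)"
      unfolding prof_def h(3) q(2) unfolding h(1) by (simp add: power2_eq_square)
    finally show "(W has_vector_derivative prof (cos t)) (at t within {0..pi})"
      by (simp add: has_real_derivative_iff_has_vector_derivative has_vector_derivative_at_within)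
  qed simp
  then show ?thesis unfolding profint_def by (simp add: W_def integral_unique)
qed

text \<open>This is the formal derivative of \<open>profint\<close> at r = 1; by convexity it bounds
  all slopes of \<open>profint\<close> on [0, 1].\<close>

lemma prof'_integral: "((\<lambda>t. cos t * prof' (cos t)) has_integral 1 / 2) {0..pi}"
proof -
  \<comment> \<open>With w = sin (t / 2) the integrand is (1 - 2 w^2) (5 - 2 w^2) / (2 - w^2)^(3/2)
    dw. A primitive is an odd cubic in w over sqrt (2 - w^2), with coefficients found by
    comparison.\<close>
  define W where "W = (\<lambda>t::real. (5 / 2 * sin (t / 2) - 2 * sin (t / 2) ^ 3) / sqrt (2 - (sin (t / 2))\<^sup>2))"
  have "((\<lambda>t. cos t * prof' (cos t)) has_integral W pi - W 0) {0..pi}"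
  proof (rule fundamental_theorem_of_calculus)
    fix t :: real assume t: "t \<in> {0..pi}"
    define w where "w = sin (t / 2)"
    define q where "q = sqrt (2 - w\<^sup>2)"
    define c where "c = cos (t / 2)"
    have h: "cos t = 1 - 2 * w\<^sup>2" "w\<^sup>2 \<le> 1" "sqrt ((1 + cos t) / (3 + cos t)) = c / q"
      using half_angle[of t] t unfolding w_def q_def c_def by auto
    have q: "q > 0" "q\<^sup>2 = 2 - w\<^sup>2" using h(2) unfolding q_def
      by (auto simp: power2_eq_square)
    have "(W has_real_derivative
        ((5 / 2 - 6 * w\<^sup>2) * (c / 2) * q - (5 / 2 * w - 2 * w ^ 3) * (- (w * c) * inverse q / 2)) / q\<^sup>2) (at t)"
      unfolding W_def q_def w_def c_def using h(2) unfolding w_def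
      by (auto intro!: derivative_eq_intros simp: field_simps power2_eq_square)
    also have "((5 / 2 - 6 * w\<^sup>2) * (c / 2) * q - (5 / 2 * w - 2 * w ^ 3) * (- (w * c) * inverse q / 2)) / q\<^sup>2
       = c / q * ((5 / 2 - 6 * w\<^sup>2) * q\<^sup>2 + (5 / 2 * w - 2 * w ^ 3) * w) / (2 * q\<^sup>2)"
      using q(1) by (simp add: field_simps power2_eq_square)
    also have "(5 / 2 - 6 * w\<^sup>2) * q\<^sup>2 + (5 / 2 * w - 2 * w ^ 3) * w = (1 - 2 * w\<^sup>2) * (5 - 2 * w\<^sup>2)"
      unfolding q(2) by (simp add: field_simps power2_eq_square power3_eq_cube)
    also have "c / q * ((1 - 2 * w\<^sup>2) * (5 - 2 * w\<^sup>2)) / (2 * q\<^sup>2) = cos t * prof' (cos t)"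
      unfolding prof'_def h(3) unfolding h(1) q(2) using q(1) h(2) by (simp add: field_simps)
    finally show "(W has_vector_derivative cos t * prof' (cos t)) (at t within {0..pi})"
      by (simp add: has_real_derivative_iff_has_vector_derivative has_vector_derivative_at_within)
  qed simp
  then show ?thesis by (simp add: W_def)
qed

text \<open>The tangent at r cos t bounds \<open>prof (r' * cos t)\<close> from below. Replacing its
  slope by \<open>prof' 0\<close> weakens the bound for either sign of cos t, and the resulting
  correction, a multiple of cos t, integrates to zero.\<close>

lemma profint_mono:
  assumes "0 \<le> r" "r \<le> r'" "r' \<le> 1"
  shows "profint r \<le> profint r'"
proof -
  have c: "((\<lambda>t. (r' - r) * prof' 0 * cos t) has_integral (r' - r) * prof' 0 * (sin pi - sin 0)) {0..pi}"
    by (intro has_integral_mult_right fundamental_theorem_of_calculus)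
       (auto intro!: derivative_eq_intros simp: has_real_derivative_iff_has_vector_derivative[symmetric])
  have "integral {0..pi} (\<lambda>t. prof (r * cos t) + (r' - r) * prof' 0 * cos t) \<le> profint r'"
    unfolding profint_def
  proof (rule integral_le)
    show "(\<lambda>t. prof (r * cos t) + (r' - r) * prof' 0 * cos t) integrable_on {0..pi}"
      using prof_integrable[of r] c assms by (intro integrable_add) auto
    show "(\<lambda>t. prof (r' * cos t)) integrable_on {0..pi}" using prof_integrable[of r'] assms by auto
    fix t :: real assume "t \<in> {0..pi}"
    have ge: "-1 \<le> r * cos t" "-1 \<le> r' * cos t" using assms by (intro mult_cos_ge; auto)+
    have "cos t * prof' 0 \<le> cos t * prof' (r * cos t)"
    proof (cases "cos t \<ge> 0")
      case True
      moreover have "prof' 0 \<le> prof' (r * cos t)" using True assms by (intro prof'_mono) auto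
      ultimately show ?thesis by (intro mult_left_mono)
    next
      case False
      then have "r * cos t \<le> 0" using assms by (simp add: mult_nonneg_nonpos)
      then show ?thesis using False ge by (intro mult_left_mono_neg prof'_mono) auto
    qed
    then have "(r' - r) * (cos t * prof' 0) \<le> (r' - r) * (cos t * prof' (r * cos t))"
      using assms by (intro mult_left_mono[of _ _ "r' - r"]) auto
    with prof_tangent[OF ge(2,1)]
    show "prof (r * cos t) + (r' - r) * prof' 0 * cos t \<le> prof (r' * cos t)"
      by (simp add: algebra_simps)
  qed
  also have "integral {0..pi} (\<lambda>t. prof (r * cos t) + (r' - r) * prof' 0 * cos t) = profint r"
    using prof_integrable[of r] c assms
    by (subst integral_add) (auto simp: profint_def integral_unique)
  finally show ?thesis .
qed

text \<open>Here the tangent is taken at r' cos t. Moving its slope to cos t only increases the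
  product with cos t, whatever the sign of cos t, and \<open>prof'_integral\<close> evaluates the
  result.\<close>

lemma profint_diff_le:
  assumes "0 \<le> r" "r \<le> r'" "r' \<le> 1"
  shows "profint r' - profint r \<le> (r' - r) / 2"
proof -
  have c: "((\<lambda>t. (r' - r) * (cos t * prof' (cos t))) has_integral (r' - r) * (1 / 2)) {0..pi}"
    by (intro has_integral_mult_right prof'_integral)
  have "profint r' \<le> integral {0..pi} (\<lambda>t. prof (r * cos t) + (r' - r) * (cos t * prof' (cos t)))"
    unfolding profint_def
  proof (rule integral_le)
    show "(\<lambda>t. prof (r * cos t) + (r' - r) * (cos t * prof' (cos t))) integrable_on {0..pi}"
      using prof_integrable[of r] c assms by (intro integrable_add) auto
    show "(\<lambda>t. prof (r' * cos t)) integrable_on {0..pi}" using prof_integrable[of r'] assms by auto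
    fix t :: real assume "t \<in> {0..pi}"
    have ge: "-1 \<le> r * cos t" "-1 \<le> r' * cos t" using assms by (intro mult_cos_ge; auto)+
    have "cos t * prof' (r' * cos t) \<le> cos t * prof' (cos t)"
    proof (cases "cos t \<ge> 0")
      case True
      moreover have "prof' (r' * cos t) \<le> prof' (cos t)"
        using True assms ge by (intro prof'_mono mult_left_le_one_le) auto
      ultimately show ?thesis by (intro mult_left_mono)
    next
      case False
      then have "cos t \<le> r' * cos t" using assms mult_right_mono_neg[of r' 1 "cos t"] by auto
      then show ?thesis using False by (intro mult_left_mono_neg prof'_mono) auto
    qed
    then have "(r' - r) * (cos t * prof' (r' * cos t)) \<le> (r' - r) * (cos t * prof' (cos t))"
      using assms by (intro mult_left_mono[of _ _ "r' - r"]) auto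
    with prof_tangent[OF ge]
    show "prof (r' * cos t) \<le> prof (r * cos t) + (r' - r) * (cos t * prof' (cos t))"
      by (simp add: algebra_simps)
  qed
  also have "\<dots> = profint r + (r' - r) / 2"
    using prof_integrable[of r] c assms
    by (subst integral_add) (auto simp: profint_def integral_unique[OF prof'_integral])
  finally show ?thesis by linarith
qed

lemma profint_ge:
  assumes "0 \<le> r" "r \<le> 1"
  shows "profint r \<ge> (3 + r) / 2"
  using profint_diff_le[of r 1] assms by (simp add: profint_1 field_simps)

section \<open>Monotonicity of the endpoint coordinates in r\<close>

definition fst_coord :: "real \<Rightarrow> real" where
  "fst_coord r = 2 * profint r / (1 - r)"

definition snd_coord :: "real \<Rightarrow> real" where
  "snd_coord r = 4 * profint r / sqrt (2 + 2 * r)"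

lemma fst_coord_strict_mono: "strict_mono_on {0<..<1} fst_coord"
proof (rule strict_mono_onI)
  fix r r' :: real assume r: "r \<in> {0<..<1}" "r' \<in> {0<..<1}" "r < r'"
  have "profint r / (1 - r) < profint r / (1 - r')"
    using r profint_ge[of r] by (intro divide_strict_left_mono) auto
  also have "\<dots> \<le> profint r' / (1 - r')"
    using r profint_mono[of r r'] by (intro divide_right_mono) auto
  finally show "fst_coord r < fst_coord r'" by (simp add: fst_coord_def)
qed

lemma snd_coord_antimono: "antimono_on {0<..<1} snd_coord"
proof (rule monotone_onI)
  fix r r' :: real assume r: "r \<in> {0<..<1}" "r' \<in> {0<..<1}" "r \<le> r'"
  define d where "d = r' - r"
  have d: "0 \<le> d" "d \<le> 1 - r" "r' = r + d" using r by (auto simp: d_def)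
  have "profint r' \<le> profint r + d / 2" using profint_diff_le[of r r'] r unfolding d_def by (simp add: field_simps)
  \<comment> \<open>The lower bound \<open>profint_ge\<close> turns the additive increment into a
    multiplicative one; it remains to compare the factor with sqrt ((1 + r') / (1 + r)).\<close>
  also have "d / 2 = (3 + r) / 2 * (d / (3 + r))" using r by (simp add: divide_simps)
  also have "\<dots> \<le> profint r * (d / (3 + r))"
    using profint_ge[of r] r d(1) by (intro mult_right_mono) auto
  finally have 1: "profint r' \<le> profint r * (1 + d / (3 + r))" by (simp add: algebra_simps)
  have "(1 + d / (3 + r))\<^sup>2 * (1 + r) \<le> 1 + r'"
  proof -
    \<comment> \<open>After expanding and cancelling, the claim is d times an inequality linear in
      d. It is tightest at d = 1 - r, where the margin is 2 - 2 r.\<close>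
    have "2 * (3 + r) * (1 + r) + d * (1 + r) \<le> 2 * (3 + r) * (1 + r) + (1 - r) * (1 + r)"
      using d r by (intro add_left_mono mult_right_mono) auto
    also have "\<dots> \<le> (3 + r)\<^sup>2" using r by (simp add: power2_eq_square algebra_simps)
    finally have "d * (2 * (3 + r) * (1 + r) + d * (1 + r)) \<le> d * (3 + r)\<^sup>2"
      using d by (intro mult_left_mono)
    then have "(3 + r + d)\<^sup>2 * (1 + r) \<le> (1 + r + d) * (3 + r)\<^sup>2"
      by (simp add: power2_eq_square algebra_simps)
    moreover have "1 + d / (3 + r) = (3 + r + d) / (3 + r)" using r by (simp add: field_simps)
    ultimately show ?thesis using r d by (simp add: power_divide pos_divide_le_eq add.assoc)
  qed
  then have "sqrt ((1 + d / (3 + r))\<^sup>2 * (2 + 2 * r)) \<le> sqrt (2 + 2 * r')"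
    by (intro real_sqrt_le_mono) (simp add: algebra_simps)
  then have 2: "(1 + d / (3 + r)) * sqrt (2 + 2 * r) \<le> sqrt (2 + 2 * r')"
    using d r by (simp add: real_sqrt_mult)
  have "profint r' * sqrt (2 + 2 * r) \<le> profint r * ((1 + d / (3 + r)) * sqrt (2 + 2 * r))"
    using mult_right_mono[OF 1, of "sqrt (2 + 2 * r)"] r by (simp add: mult.assoc)
  also have "\<dots> \<le> profint r * sqrt (2 + 2 * r')"
    using 2 profint_ge[of r] r by (intro mult_left_mono) auto
  finally show "snd_coord r \<ge> snd_coord r'"
    using r by (simp add: snd_coord_def frac_le_eq divide_simps)
qed

section \<open>Conserved quantities of the geodesic equations\<close>

text \<open>Needed on the whole line, since both the angle as a function of time and the time as a
  function of the angle are built as primitives.\<close>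

lemma antiderivative_UNIV:
  fixes f :: "real \<Rightarrow> real"
  assumes "\<And>x. isCont f x"
  obtains F where "F 0 = 0" "\<And>x. (F has_real_derivative f x) (at x)"
proof -
  have "\<exists>F. \<forall>x. -\<infinity> < ereal x \<longrightarrow> ereal x < \<infinity> \<longrightarrow> (F has_vector_derivative f x) (at x)"
    by (rule einterval_antiderivative) (auto intro: assms)
  then obtain F where F: "\<And>x. (F has_real_derivative f x) (at x)"
    by (auto simp: has_real_derivative_iff_has_vector_derivative)
  show ?thesis
    by (rule that[of "\<lambda>x. F x - F 0"]) (auto intro!: derivative_eq_intros F)
qed

text \<open>The parameters come from the turning points of x. For z = 0 the relation
  \<open>xz2\<close> is a cubic in x with roots s (1 + r), s (1 - r) and -2 s; the condition
  \<open>s\<^sup>2 * (3 + r\<^sup>2) = 1\<close> matches its linear coefficient.\<close>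

locale geodesic_angle =
  fixes x y z a b :: "real \<Rightarrow> real" and x0 r s :: real
  assumes ivp: "geodesic_ivp x0 x y z a b"
    and r: "0 < r" "r < 1"
    and s: "0 < s" "s\<^sup>2 * (3 + r\<^sup>2) = 1"
    and x0: "x0 = s * (1 + r)"
begin

lemma init: "x 0 = x0" "y 0 = sqrt (1 - x0\<^sup>2)" "z 0 = 0" "a 0 = 0" "b 0 = 0"
  using ivp by (auto simp: geodesic_ivp_def)

lemma derivs [derivative_intros]:
  "(x has_real_derivative - x t * z t) (at t)"
  "(y has_real_derivative 1/2 * y t * z t) (at t)"
  "(z has_real_derivative (x t)\<^sup>2 - 1/2 * (y t)\<^sup>2) (at t)"
  "(a has_real_derivative 2 * x t + a t * z t) (at t)"
  "(b has_real_derivative 2 * y t - 1/2 * b t * z t) (at t)"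
  using ivp by (auto simp: geodesic_ivp_def)

lemma one_minus_x0: "1 - x0\<^sup>2 = s\<^sup>2 * (2 - 2 * r)"
proof -
  have "1 - x0\<^sup>2 = s\<^sup>2 * (3 + r\<^sup>2) - (s * (1 + r))\<^sup>2" by (simp add: s x0)
  also have "\<dots> = s\<^sup>2 * (2 - 2 * r)" by (simp add: power2_eq_square algebra_simps)
  finally show ?thesis .
qed

lemma y0: "(y 0)\<^sup>2 = s\<^sup>2 * (2 - 2 * r)" "y 0 > 0"
  using r s by (auto simp: init one_minus_x0)

lemma sphere: "(x t)\<^sup>2 + (y t)\<^sup>2 + (z t)\<^sup>2 = 1"
proof -
  have "(\<lambda>t. (x t)\<^sup>2 + (y t)\<^sup>2 + (z t)\<^sup>2) t = (\<lambda>t. (x t)\<^sup>2 + (y t)\<^sup>2 + (z t)\<^sup>2) 0"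
    by (rule DERIV_isconst_all)
       (auto intro!: derivative_eq_intros derivs simp: power2_eq_square algebra_simps)
  then show ?thesis using one_minus_x0 y0(1) by (simp add: init(1,3))
qed

lemma xy: "x t * (y t)\<^sup>2 = 2 * s ^ 3 * (1 - r\<^sup>2)"
proof -
  have "(\<lambda>t. x t * (y t)\<^sup>2) t = (\<lambda>t. x t * (y t)\<^sup>2) 0"
    by (rule DERIV_isconst_all)
       (auto intro!: derivative_eq_intros derivs simp: power2_eq_square algebra_simps)
  then show ?thesis unfolding y0 unfolding init x0
    by (simp add: power2_eq_square power3_eq_cube algebra_simps)
qed

lemma xy_pos: "x t * (y t)\<^sup>2 > 0"
  unfolding xy using r s by (simp add: power_less_one_iff)

lemma x_pos: "x t > 0"
  using xy_pos[of t] by (simp add: zero_less_mult_iff)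

text \<open>The positive invariant x y^2 keeps y away from zero, so by connectedness y retains its
  initial sign.\<close>

lemma y_pos: "y t > 0"
proof (rule ccontr)
  assume "\<not> y t > 0"
  moreover have "continuous_on UNIV y"
    using derivs(2) DERIV_isCont continuous_at_imp_continuous_on by blast
  then have "connected (range y)" by (rule connected_continuous_image) simp
  ultimately have "0 \<in> range y" using y0(2) unfolding connected_iff_interval
    by (metis less_eq_real_def linorder_not_le rangeI)
  then show False using xy_pos by (metis mult_zero_right order_less_irrefl power_zero_numeral rangeE)
qed

lemma y_eq: "y t = sqrt (2 * s ^ 3 * (1 - r\<^sup>2) / x t)"
proof -
  have "(y t)\<^sup>2 = 2 * s ^ 3 * (1 - r\<^sup>2) / x t"
    using xy[of t] x_pos[of t] by (simp add: nonzero_eq_divide_eq mult.commute)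
  from real_sqrt_unique[OF this] show ?thesis using y_pos[of t] by simp
qed

section \<open>The angle variable\<close>

text \<open>The angular velocity. By \<open>xz2\<close>, x^2 z^2 = x (x + 2 s) (r^2 s^2 - (x -
  s)^2), and the last factor is (r s sin \<theta>)^2 when x = s (1 + r cos \<theta>). Comparing with
  x' = -x z leaves x (x + 2 s) as the square of \<theta>'.\<close>

definition speed :: "real \<Rightarrow> real" where "speed t = sqrt (x t * (x t + 2 * s))"

lemma speed: "speed t > 0" "(speed t)\<^sup>2 = x t * (x t + 2 * s)"
  using x_pos[of t] s by (auto simp: speed_def)

lemma speed_deriv: "(speed has_real_derivative - (x t + s) * x t * z t / speed t) (at t)"
proof -
  have pos: "x t * (x t + 2 * s) > 0" using speed[of t] by (metis zero_less_power)
  have "((\<lambda>t. x t * (x t + 2 * s)) has_real_derivative - 2 * (x t + s) * x t * z t) (at t)"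
    by (auto intro!: derivative_eq_intros derivs simp: algebra_simps)
  from DERIV_chain2[OF DERIV_real_sqrt[OF pos] this]
  have "(speed has_real_derivative inverse (speed t) / 2 * (- 2 * (x t + s) * x t * z t)) (at t)"
    unfolding speed_def[abs_def] .
  also have "inverse (speed t) / 2 * (- 2 * (x t + s) * x t * z t) = - (x t + s) * x t * z t / speed t"
    using speed(1)[of t] by (simp add: field_simps)
  finally show ?thesis .
qed

lemma xz2: "x t * (z t)\<^sup>2 = x t - x t ^ 3 - 2 * s ^ 3 * (1 - r\<^sup>2)"
proof -
  have "x t * (z t)\<^sup>2 = x t * (1 - (x t)\<^sup>2) - x t * (y t)\<^sup>2"
    unfolding sphere[of t, symmetric] by (simp add: algebra_simps)
  then show ?thesis unfolding xy by (simp add: algebra_simps power2_eq_square power3_eq_cube)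
qed

text \<open>Cosine and sine of the angle \<open>\<theta>\<close>.\<close>
definition C :: "real \<Rightarrow> real" where "C t = (x t / s - 1) / r"
definition S :: "real \<Rightarrow> real" where "S t = x t * z t / (r * s * speed t)"

lemma x_eq: "x t = s * (1 + r * C t)"
  using r s by (simp add: C_def)

lemma z_eq: "z t = r * s * speed t * S t / x t"
  using r s speed(1)[of t] x_pos[of t] by (simp add: S_def)

lemma C_deriv: "(C has_real_derivative - S t * speed t) (at t)"
proof -
  have "(C has_real_derivative - x t * z t / s / r) (at t)"
    unfolding C_def[abs_def] using r s by (auto intro!: derivative_eq_intros derivs)
  also have "- x t * z t / s / r = - S t * speed t"
    using r s speed(1)[of t] by (simp add: S_def)
  finally show ?thesis .
qed

text \<open>Together with \<open>C_deriv\<close> this says that (C, S) rotates with angular velocity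
  \<open>speed\<close>. After the quotient rule, y and z are eliminated by the invariants, and a
  polynomial identity in x remains.\<close>

lemma S_deriv: "(S has_real_derivative C t * speed t) (at t)"
proof -
  define h where "h = s ^ 3 * (1 - r\<^sup>2)"
  have h: "x t * (z t)\<^sup>2 = x t - x t ^ 3 - 2 * h" "x t * (y t)\<^sup>2 = 2 * h"
    using xz2 xy by (auto simp: h_def)
  \<comment> \<open>The normalisation of s in terms of h. It removes exactly the remainder that
    keeps the polynomial below from being divisible by x - s.\<close>
  have "s * (s\<^sup>2 * (3 + r\<^sup>2)) + h - 4 * s ^ 3 = 0"
    by (simp add: h_def algebra_simps power2_eq_square power3_eq_cube)
  then have h0: "s + h - 4 * s ^ 3 = 0" unfolding s by simp
  define D where "D = x t ^ 3 - x t * (z t)\<^sup>2 - x t * (y t)\<^sup>2 / 2"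
  have D: "D = 2 * x t ^ 3 - x t + h" by (simp add: D_def h)
  have "D * (x t + 2 * s) + x t * (z t)\<^sup>2 * (x t + s) =
     (x t - s) * (x t * (x t + 2 * s) * (x t + 2 * s)) - x t * (s + h - 4 * s ^ 3)"
    unfolding D h by (simp add: algebra_simps power2_eq_square power3_eq_cube)
  also have "\<dots> = (x t - s) * ((speed t)\<^sup>2 * (x t + 2 * s))" by (simp add: speed h0)
  finally have "x t * (D * (x t + 2 * s) + x t * (z t)\<^sup>2 * (x t + s)) =
     x t * ((x t - s) * ((speed t)\<^sup>2 * (x t + 2 * s)))" by simp
  then have key: "D * (speed t)\<^sup>2 + (x t)\<^sup>2 * (z t)\<^sup>2 * (x t + s)
      = (x t - s) * (speed t)\<^sup>2 * (speed t)\<^sup>2"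
    unfolding speed by (simp add: algebra_simps power2_eq_square)
  have D': "((\<lambda>t. x t * z t) has_real_derivative D) (at t)"
    unfolding D_def
    by (auto intro!: derivative_eq_intros derivs simp: algebra_simps power2_eq_square power3_eq_cube)
  have "(S has_real_derivative
      (D * (r * s * speed t) - x t * z t * (r * s * (- (x t + s) * x t * z t / speed t)))
        / (r * s * speed t)\<^sup>2) (at t)"
    unfolding S_def power2_eq_square using r s speed(1)[of t]
    by (intro DERIV_divide D' DERIV_cmult speed_deriv) auto
  also have "(D * (r * s * speed t) - x t * z t * (r * s * (- (x t + s) * x t * z t / speed t)))
        / (r * s * speed t)\<^sup>2
      = (D * (speed t)\<^sup>2 + (x t)\<^sup>2 * (z t)\<^sup>2 * (x t + s)) / (r * s * speed t * (speed t)\<^sup>2)"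
    using r s(1) speed(1)[of t] by (simp add: divide_simps) (simp add: algebra_simps power2_eq_square)
  also have "\<dots> = C t * speed t"
    unfolding key C_def using r s(1) speed(1)[of t] by (simp add: divide_simps power2_eq_square)
  finally show ?thesis .
qed

lemma CS_0: "C 0 = 1" "S 0 = 0"
  using r s by (auto simp: C_def S_def init x0)

text \<open>The value of \<^term>\<open>speed\<close> at the time when the angle is \<open>\<phi>\<close>.\<close>
definition wt :: "real \<Rightarrow> real" where
  "wt \<phi> = s * sqrt ((1 + r * cos \<phi>) * (3 + r * cos \<phi>))"

lemma rcos: "1 + r * cos \<phi> > 0" "3 + r * cos \<phi> > 0"
proof -
  have "\<bar>r * cos \<phi>\<bar> \<le> r * 1" unfolding abs_mult using r by (intro mult_mono) auto
  then show "1 + r * cos \<phi> > 0" "3 + r * cos \<phi> > 0" using r by auto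
qed

lemma wt_pos: "wt \<phi> > 0"
  using rcos[of \<phi>] s by (simp add: wt_def)

text \<open>The origin of the profile: multiplied by s, this says that x^2 dt becomes s
  \<open>prof (r * cos \<phi>)\<close> d\<phi> when time is replaced by the angle.\<close>

lemma prof_wt: "prof (r * cos \<phi>) * wt \<phi> = s * (1 + r * cos \<phi>)\<^sup>2"
proof -
  define u where "u = r * cos \<phi>"
  have u: "1 + u > 0" "3 + u > 0" using rcos[of \<phi>] by (auto simp: u_def)
  have "sqrt ((1 + u) / (3 + u)) * sqrt ((1 + u) * (3 + u)) = sqrt ((1 + u)\<^sup>2)"
    unfolding real_sqrt_mult[symmetric] using u by (simp add: power2_eq_square)
  also have "\<dots> = 1 + u" using u by simp
  finally have "(1 + u) * s * (sqrt ((1 + u) / (3 + u)) * sqrt ((1 + u) * (3 + u))) = (1 + u) * s * (1 + u)"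
    by simp
  then show ?thesis unfolding u_def prof_def wt_def power2_eq_square by (simp only: mult_ac)
qed

lemma angle_exists:
  obtains \<Theta> where "\<Theta> 0 = 0" "\<And>t. C t = cos (\<Theta> t)" "\<And>t. S t = sin (\<Theta> t)"
    "\<And>t. speed t = wt (\<Theta> t)" "\<And>t. (\<Theta> has_real_derivative speed t) (at t)"
proof -
  obtain \<Theta> where \<Theta>: "\<Theta> 0 = 0" "\<And>t. (\<Theta> has_real_derivative speed t) (at t)"
    using antiderivative_UNIV[of speed] DERIV_isCont[OF speed_deriv] by blast
  \<comment> \<open>The pair \<open>?p\<close>, \<open>?q\<close> is the point (C, S) rotated back
    by \<Theta>. Both rotate at the same rate, so the pair stays at its initial value (1,
    0).\<close>
  let ?p = "\<lambda>t. C t * cos (\<Theta> t) + S t * sin (\<Theta> t)"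
  let ?q = "\<lambda>t. S t * cos (\<Theta> t) - C t * sin (\<Theta> t)"
  have "?p t = ?p 0" for t
    by (rule DERIV_isconst_all)
       (auto intro!: derivative_eq_intros C_deriv S_deriv \<Theta>(2) simp: algebra_simps)
  then have p: "?p t = 1" for t by (simp add: \<Theta> CS_0)
  have "?q t = ?q 0" for t
    by (rule DERIV_isconst_all)
       (auto intro!: derivative_eq_intros C_deriv S_deriv \<Theta>(2) simp: algebra_simps)
  then have q: "?q t = 0" for t by (simp add: \<Theta> CS_0)
  have sc: "(sin (\<Theta> t))\<^sup>2 + (cos (\<Theta> t))\<^sup>2 = 1" for t by simp
  have C: "C t = cos (\<Theta> t)" for t
  proof -
    have "C t * ((sin (\<Theta> t))\<^sup>2 + (cos (\<Theta> t))\<^sup>2) = ?p t * cos (\<Theta> t) - ?q t * sin (\<Theta> t)"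
      by algebra
    then show ?thesis unfolding p q sc by simp
  qed
  have S: "S t = sin (\<Theta> t)" for t
  proof -
    have "S t * ((sin (\<Theta> t))\<^sup>2 + (cos (\<Theta> t))\<^sup>2) = ?p t * sin (\<Theta> t) + ?q t * cos (\<Theta> t)"
      by algebra
    then show ?thesis unfolding p q sc by simp
  qed
  have "speed t = wt (\<Theta> t)" for t
  proof -
    have "x t * (x t + 2 * s) = s\<^sup>2 * ((1 + r * cos (\<Theta> t)) * (3 + r * cos (\<Theta> t)))"
      unfolding x_eq C by (simp add: power2_eq_square algebra_simps)
    then show ?thesis using s unfolding speed_def wt_def by (simp add: real_sqrt_mult)
  qed
  then show ?thesis using that \<Theta> C S by blast
qed

section \<open>The period and the endpoint at half the period\<close>

lemma endpoint:
  defines "P \<equiv> minimal_period (\<lambda>t. (x t, y t, z t))"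
  shows "a (P / 2) = fst_coord r" "b (P / 2) = snd_coord r"
proof -
  obtain \<Theta> where \<Theta>: "\<Theta> 0 = 0" "\<And>t. C t = cos (\<Theta> t)" "\<And>t. S t = sin (\<Theta> t)"
    "\<And>t. speed t = wt (\<Theta> t)" "\<And>t. (\<Theta> has_real_derivative speed t) (at t)"
    by (rule angle_exists, rule that)
  have "isCont (\<lambda>\<phi>. 1 / wt \<phi>) \<phi>" for \<phi>
    using wt_pos[of \<phi>] unfolding wt_def by (intro continuous_intros) auto
  \<comment> \<open>T is the time as a function of the angle, and is shown below to be the inverse
    of \<Theta>.\<close>
  then obtain T where T: "T 0 = 0" "\<And>\<phi>. (T has_real_derivative 1 / wt \<phi>) (at \<phi>)"
    using antiderivative_UNIV by metis
  have T_mono: "strict_mono T"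
    by (rule strict_monoI, rule DERIV_pos_imp_increasing) (use T(2) wt_pos in \<open>auto intro!: exI\<close>)
  have T_\<Theta>: "T (\<Theta> t) = t" for t
  proof -
    have "T (\<Theta> t) - t = T (\<Theta> 0) - 0"
    proof (rule DERIV_isconst_all[of "\<lambda>t. T (\<Theta> t) - t"], rule allI)
      fix t
      have "((\<lambda>t. T (\<Theta> t)) has_real_derivative 1 / wt (\<Theta> t) * speed t) (at t)"
        by (rule DERIV_chain2[OF T(2) \<Theta>(5)])
      moreover have "1 / wt (\<Theta> t) * speed t = 1" using wt_pos[of "\<Theta> t"] by (simp add: \<Theta>(4))
      ultimately show "((\<lambda>t. T (\<Theta> t) - t) has_real_derivative 0) (at t)"
        by (auto intro!: derivative_eq_intros)
    qed
    then show ?thesis by (simp add: T \<Theta>)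
  qed
  have T_inj: "T u = T v \<Longrightarrow> u = v" for u v
    using T_mono by (simp add: strict_mono_eq)
  have \<Theta>_T: "\<Theta> (T \<phi>) = \<phi>" for \<phi> by (rule T_inj, rule T_\<Theta>)
  have T_shift: "T (\<phi> + 2 * pi) = T \<phi> + T (2 * pi)" for \<phi>
  proof -
    have "(\<lambda>\<phi>. T (\<phi> + 2 * pi) - T \<phi>) \<phi> = (\<lambda>\<phi>. T (\<phi> + 2 * pi) - T \<phi>) 0"
      by (rule DERIV_isconst_all)
         (auto intro!: derivative_eq_intros DERIV_chain2[OF T(2)] T(2) simp: wt_def)
    then show ?thesis by (simp add: T)
  qed
  \<comment> \<open>The reflection \<phi> to 2 pi - \<phi> preserves \<open>wt\<close>, so both
    halves of a turn take the same time.\<close>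
  have T_half: "T (2 * pi) = 2 * T pi"
  proof -
    have "(\<lambda>\<phi>. T (2 * pi - \<phi>) + T \<phi>) pi = (\<lambda>\<phi>. T (2 * pi - \<phi>) + T \<phi>) 0"
      by (rule DERIV_isconst_all)
         (auto intro!: derivative_eq_intros DERIV_chain2[OF T(2)] T(2) simp: wt_def cos_diff)
    then show ?thesis by (simp add: T)
  qed
  have "P = T (2 * pi)"
    unfolding P_def minimal_period_def
  proof (rule Least_equality)
    have "x (t + T (2 * pi)) = x t \<and> y (t + T (2 * pi)) = y t \<and> z (t + T (2 * pi)) = z t" for t
    proof -
      have "\<Theta> (t + T (2 * pi)) = \<Theta> t + 2 * pi"
        by (rule T_inj) (simp add: T_\<Theta> T_shift)
      then have "C (t + T (2 * pi)) = C t" "S (t + T (2 * pi)) = S t" by (auto simp: \<Theta>)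
      moreover from this have "x (t + T (2 * pi)) = x t" by (simp add: x_eq)
      ultimately show ?thesis by (simp add: z_eq[of "t + _"] z_eq[of t] y_eq speed_def)
    qed
    moreover have "T 0 < T (2 * pi)" using T_mono by (simp add: strict_mono_less)
    ultimately show "0 < T (2 * pi) \<and> (\<forall>t. (x (t + T (2 * pi)), y (t + T (2 * pi)), z (t + T (2 * pi))) = (x t, y t, z t))"
      by (simp add: T)
  next
    fix p assume p: "0 < p \<and> (\<forall>t. (x (t + p), y (t + p), z (t + p)) = (x t, y t, z t))"
    \<comment> \<open>The first component suffices for minimality: x returns to its initial value
      only when cos \<Theta> = 1, that is, after whole turns.\<close>
    then have "x (0 + p) = x 0" by blast
    then have "C p = C 0" by (simp add: C_def)
    then have "cos (\<Theta> p) = 1" by (simp add: \<Theta>)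
    then obtain n :: int where n: "\<Theta> p = of_int n * 2 * pi" using cos_one_2pi_int by blast
    have "T 0 < T (\<Theta> p)" using p by (simp add: T T_\<Theta>)
    then have "\<Theta> p > 0" using T_mono by (simp add: strict_mono_less)
    then have "n \<ge> 1" unfolding n by (simp add: zero_less_mult_iff)
    then have "2 * pi \<le> \<Theta> p" unfolding n by simp
    then have "T (2 * pi) \<le> T (\<Theta> p)" using T_mono by (simp add: strict_mono_less_eq)
    then show "T (2 * pi) \<le> p" by (simp add: T_\<Theta>)
  qed
  then have half: "\<Theta> (P / 2) = pi" by (simp add: T_half \<Theta>_T)
  have "isCont (\<lambda>\<phi>. s * prof (r * cos \<phi>)) \<phi>" for \<phi>
    unfolding prof_def using rcos[of \<phi>] by (intro continuous_intros) auto
  \<comment> \<open>Along the motion K is the integral of x^2 over time, written as a function of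
    the angle; hence both coordinates can be read off from \<open>K pi\<close>.\<close>
  then obtain K where K: "K 0 = 0" "\<And>\<phi>. (K has_real_derivative s * prof (r * cos \<phi>)) (at \<phi>)"
    using antiderivative_UNIV by metis
  have "((\<lambda>\<phi>. s * prof (r * cos \<phi>)) has_integral K pi - K 0) {0..pi}"
    by (intro fundamental_theorem_of_calculus)
       (auto simp: has_real_derivative_iff_has_vector_derivative[symmetric]
         intro: has_field_derivative_at_within K)
  from integral_unique[OF this] have K_pi: "K pi = s * profint r"
    by (simp add: profint_def K)
  have K_\<Theta>: "((\<lambda>t. K (\<Theta> t)) has_real_derivative (x t)\<^sup>2) (at t)" for t
  proof -
    have "((\<lambda>t. K (\<Theta> t)) has_real_derivative s * prof (r * cos (\<Theta> t)) * speed t) (at t)"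
      by (rule DERIV_chain2[OF K(2) \<Theta>(5)])
    moreover have "s * prof (r * cos (\<Theta> t)) * speed t = (x t)\<^sup>2"
      using prof_wt[of "\<Theta> t"] by (simp add: \<Theta> x_eq power_mult_distrib power2_eq_square[of s])
    ultimately show ?thesis by simp
  qed
  have "(\<lambda>t. a t * x t - 2 * K (\<Theta> t)) (P / 2) = (\<lambda>t. a t * x t - 2 * K (\<Theta> t)) 0"
    by (rule DERIV_isconst_all)
       (auto intro!: derivative_eq_intros derivs K_\<Theta> simp: power2_eq_square algebra_simps)
  then have ax: "a (P / 2) * x (P / 2) = 2 * (s * profint r)"
    by (simp add: init \<Theta> K half K_pi)
  \<comment> \<open>The summand 4 z trades the term 2 y^2 in (b y)' for 4 x^2, and contributes
    nothing at the ends because z vanishes at angles 0 and pi.\<close>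
  have "(\<lambda>t. b t * y t + 4 * z t - 4 * K (\<Theta> t)) (P / 2) = (\<lambda>t. b t * y t + 4 * z t - 4 * K (\<Theta> t)) 0"
    by (rule DERIV_isconst_all)
       (auto intro!: derivative_eq_intros derivs K_\<Theta> simp: power2_eq_square algebra_simps)
  moreover have z: "z (P / 2) = 0" by (simp add: z_eq \<Theta> half)
  ultimately have b_y: "b (P / 2) * y (P / 2) = 4 * (s * profint r)"
    by (simp add: init \<Theta> K half K_pi)
  have x: "x (P / 2) = s * (1 - r)" by (simp add: x_eq \<Theta> half)
  show "a (P / 2) = fst_coord r"
  proof -
    have "s * (a (P / 2) * (1 - r)) = s * (2 * profint r)" using ax unfolding x by (simp add: mult_ac)
    then show ?thesis using s r by (simp add: fst_coord_def nonzero_eq_divide_eq)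
  qed
  have "(y (P / 2))\<^sup>2 = s\<^sup>2 * (3 + r\<^sup>2) - (s * (1 - r))\<^sup>2"
    using sphere[of "P / 2"] unfolding x z s by simp
  also have "\<dots> = s\<^sup>2 * (2 + 2 * r)" by (simp add: power2_eq_square algebra_simps)
  finally have "y (P / 2) = sqrt (s\<^sup>2 * (2 + 2 * r))"
    using y_pos by (metis abs_of_pos real_sqrt_abs)
  then have y: "y (P / 2) = s * sqrt (2 + 2 * r)" using s by (simp add: real_sqrt_mult)
  show "b (P / 2) = snd_coord r"
  proof -
    have "s * (b (P / 2) * sqrt (2 + 2 * r)) = s * (4 * profint r)"
      using b_y unfolding y by (simp add: mult_ac)
    then show ?thesis using s r by (simp add: snd_coord_def nonzero_eq_divide_eq)
  qed
qed

end

section \<open>From the initial value to r, and the graph\<close>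

lemma angle_parameter:
  assumes "x0 \<in> {1 / sqrt 3 <..< 1}"
  obtains r s where "0 < r" "r < 1" "0 < s" "s\<^sup>2 * (3 + r\<^sup>2) = 1" "x0 = s * (1 + r)"
proof -
  define q where "q = sqrt (4 - 3 * x0\<^sup>2)"
  have x0: "0 < x0" "x0 < 1" using assms by (auto intro: less_trans[OF _ assms[simplified, THEN conjunct1]])
  have x2: "x0\<^sup>2 < 1" "1 < 3 * x0\<^sup>2"
  proof -
    show "x0\<^sup>2 < 1" using x0 by (simp add: power_less_one_iff)
    have "(1 / sqrt 3)\<^sup>2 < x0\<^sup>2" using assms by (intro power_strict_mono) auto
    then show "1 < 3 * x0\<^sup>2" by (simp add: power_divide)
  qed
  have q: "q > 0" "q\<^sup>2 = 4 - 3 * x0\<^sup>2" using x2 by (auto simp: q_def)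
  have q1: "q > x0" by (rule power2_less_imp_less) (use q x2 x0 in auto)
  have q2: "q < 3 * x0" by (rule power2_less_imp_less) (use q x2 x0 in \<open>auto simp: power_mult_distrib\<close>)
  \<comment> \<open>Substituting r = x0 / s - 1 into the normalisation gives 4 s^2 - 2 x0 s + x0^2 -
    1 = 0, of which this is the larger root. Then r < 1 amounts to q > x0, that is x0 < 1, and r > 0
    to q < 3 x0, that is x0 > 1 / sqrt 3.\<close>
  define s where "s = (x0 + q) / 4"
  define r where "r = (x0 - s) / s"
  have s: "s > 0" using q x0 by (simp add: s_def)
  have rs: "s * r = x0 - s" using s by (simp add: r_def)
  have "s\<^sup>2 * (3 + r\<^sup>2) = 3 * s\<^sup>2 + (s * r)\<^sup>2" by (simp add: algebra_simps)
  also have "\<dots> = (3 * x0\<^sup>2 + q\<^sup>2) / 4" unfolding rs unfolding s_def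
    by (simp add: field_simps power2_eq_square)
  finally have "s\<^sup>2 * (3 + r\<^sup>2) = 1" by (simp add: q)
  moreover have "0 < r" "r < 1" using s q1 q2 by (auto simp: r_def s_def field_simps)
  moreover have "x0 = s * (1 + r)" using rs by (simp add: algebra_simps)
  ultimately show ?thesis using that s by blast
qed

theorem theorem15:
  fixes x y z a b :: "real \<Rightarrow> real \<Rightarrow> real"
  assumes "\<And>x0. x0 \<in> {1 / sqrt 3 <..< 1} \<Longrightarrow> geodesic_ivp x0 (x x0) (y x0) (z x0) (a x0) (b x0)"
  shows "\<exists>(D :: real set) (f :: real \<Rightarrow> real). antimono_on D f \<and>
           boundary0_N_plus x y z a b = {(u, f u, 0) | u. u \<in> D}"
proof -
  let ?I = "{1 / sqrt 3 <..< 1 :: real}"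
  let ?P = "\<lambda>x0. minimal_period (\<lambda>t. (x x0 t, y x0 t, z x0 t))"
  have "\<exists>r. r \<in> {0<..<1} \<and> a x0 (?P x0 / 2) = fst_coord r \<and> b x0 (?P x0 / 2) = snd_coord r"
    if x0: "x0 \<in> ?I" for x0
  proof -
    obtain r s where rs: "0 < r" "r < 1" "0 < s" "s\<^sup>2 * (3 + r\<^sup>2) = 1" "x0 = s * (1 + r)"
      using angle_parameter[OF x0] .
    interpret geodesic_angle "x x0" "y x0" "z x0" "a x0" "b x0" x0 r s
      using rs assms[OF x0] by unfold_locales auto
    show ?thesis using endpoint rs by auto
  qed
  then have "\<forall>x0\<in>?I. \<exists>r. r \<in> {0<..<1} \<and>
      a x0 (?P x0 / 2) = fst_coord r \<and> b x0 (?P x0 / 2) = snd_coord r"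
    by blast
  from bchoice[OF this] obtain \<rho> where \<rho>: "\<And>x0. x0 \<in> ?I \<Longrightarrow> \<rho> x0 \<in> {0<..<1} \<and>
      a x0 (?P x0 / 2) = fst_coord (\<rho> x0) \<and> b x0 (?P x0 / 2) = snd_coord (\<rho> x0)"
    by blast
  have inj: "inj_on fst_coord {0<..<1}"
    using fst_coord_strict_mono by (rule strict_mono_on_imp_inj_on)
  \<comment> \<open>Strict monotonicity of \<open>fst_coord\<close> lets r be recovered from the
    first coordinate, so the second one is a function of it. The domain \<open>?D\<close> below
    consists of the first coordinates actually attained.\<close>
  define f where "f = snd_coord \<circ> the_inv_into {0<..<1} fst_coord"
  have f: "f (fst_coord r) = snd_coord r" if "r \<in> {0<..<1}" for r
    using that by (simp add: f_def the_inv_into_f_f[OF inj])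
  let ?D = "fst_coord ` \<rho> ` ?I"
  have "antimono_on ?D f"
  proof (rule monotone_onI)
    fix u v assume uv: "u \<in> ?D" "v \<in> ?D" "u \<le> v"
    then obtain p q where pq: "p \<in> ?I" "q \<in> ?I" "u = fst_coord (\<rho> p)" "v = fst_coord (\<rho> q)"
      by blast
    have "\<rho> p \<le> \<rho> q"
      using uv(3) pq \<rho> strict_mono_onD[OF fst_coord_strict_mono, of "\<rho> q" "\<rho> p"] by force
    then show "f u \<ge> f v"
      using pq \<rho> f monotone_onD[OF snd_coord_antimono, of "\<rho> p" "\<rho> q"] by auto
  qed
  moreover have "boundary0_N_plus x y z a b = {(u, f u, 0) | u. u \<in> ?D}"
    unfolding boundary0_N_plus_def using \<rho> f by (auto; force)
  ultimately show ?thesis by blast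
qed

end
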